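(* Let $\alpha>0$, $\lambda\in\mathbb{R}$, let $r\ge 0$ be an integer, and let $X_{\lambda,r}$ be the $r$-truncated degenerate Poisson random variable with parameter $\alpha$. For $\lambda\neq-\frac{1}{\alpha}$, we have $$\mathrm{Var}(X_{\lambda,r})=\frac{1}{(1+\alpha\lambda)^{2}}\left(\alpha+\frac{\alpha^{r+1}}{r!}\frac{(1)_{r+1,\lambda}}{e_{\lambda}(\alpha)-e_{\lambda,r}(\alpha)}\right)\left(1-\frac{\alpha^{r+1}}{r!}\frac{(1)_{r+1,\lambda}}{e_{\lambda}(\alpha)-e_{\lambda,r}(\alpha)}\right)+\frac{1}{1+\alpha\lambda}\,\frac{r\,(1)_{r+1,\lambda}}{e_{\lambda}(\alpha)-e_{\lambda,r}(\alpha)}\,\frac{\alpha^{r+1}}{r!}.$$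
   Context: For $\lambda,x\in\mathbb{R}$ put $(x)_{0,\lambda}=1$ and $(x)_{n,\lambda}=x(x-\lambda)(x-2\lambda)\cdots(x-(n-1)\lambda)$ for $n\ge 1$. The degenerate exponential function is $e_{\lambda}(t)=(1+\lambda t)^{1/\lambda}=\sum_{k=0}^{\infty}(1)_{k,\lambda}\frac{t^k}{k!}$ (for $\lambda=0$, $e_0(t)=e^t$), and for an integer $r\ge 0$, $e_{\lambda,r}(t)=\sum_{k=0}^{r}(1)_{k,\lambda}\frac{t^k}{k!}$. The $r$-truncated degenerate Poisson random variable with parameter $\alpha>0$ is the random variable $X_{\lambda,r}$ taking values in $\{r+1,r+2,\dots\}$ with probability mass function $$p_{\lambda,r}(k)=P\{X_{\lambda,r}=k\}=\frac{(1)_{k,\lambda}}{e_{\lambda}(\alpha)-e_{\lambda,r}(\alpha)}\,\frac{\alpha^k}{k!},\qquad k=r+1,r+2,\dots.$$ To say that $X_{\lambda,r}$ is such a random variable presupposes that $\lambda,\alpha,r$ are such that this is a probability mass function: the series $\sum_k (1)_{k,\lambda}\alpha^k/k!$ converges to $e_\lambda(\alpha)$, the denominator $e_{\lambda}(\alpha)-e_{\lambda,r}(\alpha)$ is nonzero, and all values $p_{\lambda,r}(k)$ are nonnegative (so that they sum to $1$). *)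

theory Defs
  imports "HOL-Probability.Probability"
begin

definition degenerate_falling :: "real \<Rightarrow> real \<Rightarrow> nat \<Rightarrow> real" where
  "degenerate_falling x lam n = (\<Prod>i<n. x - real i * lam)"

(* For lam = 0 the expression (1 + lam * t) powr (1 / lam) is not meaningful in HOL, so the
   limiting value exp t is given separately.  The real power is only the intended one for
   1 + lam * t > 0. *)
definition degenerate_exp :: "real \<Rightarrow> real \<Rightarrow> real" where
  "degenerate_exp lam t = (if lam = 0 then exp t else (1 + lam * t) powr (1 / lam))"

definition degenerate_exp_trunc :: "real \<Rightarrow> nat \<Rightarrow> real \<Rightarrow> real" where
  "degenerate_exp_trunc lam r t = (\<Sum>k\<le>r. degenerate_falling 1 lam k * t ^ k / fact k)"

definition trunc_deg_poisson_mass :: "real \<Rightarrow> real \<Rightarrow> nat \<Rightarrow> nat \<Rightarrow> real" where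
  "trunc_deg_poisson_mass lam \<alpha> r k =
     degenerate_falling 1 lam k / (degenerate_exp lam \<alpha> - degenerate_exp_trunc lam r \<alpha>)
       * (\<alpha> ^ k / fact k)"

(* The parameters for which trunc_deg_poisson_mass is a probability mass function on {r+1..}. *)
definition trunc_deg_poisson_params :: "real \<Rightarrow> real \<Rightarrow> nat \<Rightarrow> bool" where
  "trunc_deg_poisson_params lam \<alpha> r \<longleftrightarrow>
     (\<lambda>k. degenerate_falling 1 lam k * \<alpha> ^ k / fact k) sums degenerate_exp lam \<alpha> \<and>
     degenerate_exp lam \<alpha> - degenerate_exp_trunc lam r \<alpha> \<noteq> 0 \<and>
     (\<forall>k\<ge>r + 1. trunc_deg_poisson_mass lam \<alpha> r k \<ge> 0)"

(* Measurability into the discrete space on {r+1..} includes that X takes its values there. *)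
definition trunc_deg_poisson_rv ::
    "'a measure \<Rightarrow> ('a \<Rightarrow> nat) \<Rightarrow> real \<Rightarrow> real \<Rightarrow> nat \<Rightarrow> bool" where
  "trunc_deg_poisson_rv M X lam \<alpha> r \<longleftrightarrow>
     trunc_deg_poisson_params lam \<alpha> r \<and>
     X \<in> measurable M (count_space {r + 1..}) \<and>
     (\<forall>k\<ge>r + 1. measure M {\<omega> \<in> space M. X \<omega> = k} = trunc_deg_poisson_mass lam \<alpha> r k)"

end

theory Submission
  imports Defs
begin

text \<open>
  The mass function satisfies (k + 1) p(k + 1) + \<alpha> \<lambda> k p(k) = \<alpha> p(k), and the same relation
  multiplied by k + 1.  Summing both over k > r gives linear equations for the first two moments,
  each with the coefficient 1 + \<alpha> \<lambda>.  Provided \<alpha> \<lambda> > -1, the partial sums are controlled by the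
  same relations, so the moments exist.  For \<alpha> \<lambda> < -1 the relation forces k p(k) to be
  nondecreasing, and then p is not summable.
\<close>

text \<open>Adding the recurrence over an initial segment telescopes to
  \<open>(1 + b) * S + x n = x 0 + Y\<close>, where \<open>S\<close> and \<open>Y\<close> are the
  partial sums of \<open>x\<close> and \<open>y\<close>. Since \<open>x n\<close> is nonnegative and
  \<open>1 + b\<close> is positive, this bounds \<open>S\<close>, so the nonnegative series
  converges; the limit of the recurrence then gives its value.\<close>

lemma sums_affine_recurrence:
  fixes x y :: "nat \<Rightarrow> real"
  assumes nonneg: "\<And>n. x n \<ge> 0" and rec: "\<And>n. x (Suc n) + b * x n = y n"
    and y: "y sums s" and b: "b > -1"
  shows "x sums ((x 0 + s) / (1 + b))"
proof -
  have partial: "(\<Sum>k<Suc n. x k) + b * (\<Sum>k<n. x k) = x 0 + (\<Sum>k<n. y k)" for n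
    by (induction n) (auto simp: rec[symmetric] algebra_simps)
  obtain B where B: "\<And>n. (\<Sum>k<n. y k) \<le> B"
    using convergent_imp_Bseq[OF convergentI[OF y[unfolded sums_def]]]
    unfolding Bseq_def real_norm_def by (meson abs_le_D1)
  have "summable x"
  proof (rule summableI_nonneg_bounded[OF nonneg])
    fix n
    have "(1 + b) * (\<Sum>k<n. x k) \<le> (\<Sum>k<Suc n. x k) + b * (\<Sum>k<n. x k)"
      using nonneg[of n] by (simp add: algebra_simps)
    also have "\<dots> \<le> x 0 + B"
      unfolding partial using B[of n] by simp
    finally show "(\<Sum>k<n. x k) \<le> (x 0 + B) / (1 + b)"
      using b by (simp add: field_simps)
  qed
  then have x: "x sums suminf x" by (rule summable_sums)
  have "(\<lambda>n. x (Suc n) + b * x n) sums ((suminf x - x 0) + b * suminf x)"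
    by (intro sums_add sums_mult x) (simp add: sums_Suc_iff x)
  with y have "(suminf x - x 0) + b * suminf x = s"
    unfolding rec by (rule sums_unique2[rotated])
  then have "suminf x = (x 0 + s) / (1 + b)"
    using b by (simp add: field_simps)
  with x show ?thesis by simp
qed

text \<open>The nondecreasing quantity \<open>(n + a) * q n\<close> never drops below its initial
  value \<open>a * q 0 > 0\<close>, so \<open>q\<close> dominates a multiple of a shifted harmonic
  series.\<close>

lemma not_summable_of_growth:
  fixes q :: "nat \<Rightarrow> real"
  assumes nonneg: "\<And>n. q n \<ge> 0" and pos: "q 0 > 0"
    and mono: "\<And>n. (real n + a) * q n \<le> (real (Suc n) + a) * q (Suc n)"
    and a: "a > 0"
  shows "\<not> summable q"
proof
  assume "summable q"
  have lower: "a * q 0 \<le> (real n + a) * q n" for n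
  proof (induction n)
    case (Suc n)
    with mono[of n] show ?case by linarith
  qed simp
  \<comment> \<open>Replacing the real shift \<open>a\<close> by a natural number above it makes the
    minorant a genuine index shift of the harmonic series.\<close>
  obtain m :: nat where m: "a \<le> real m" "m > 0"
    by (metis a less_le_trans of_nat_0_less_iff real_arch_simple)
  have "summable (\<lambda>n. a * q 0 / (real n + real m))"
  proof (rule summable_comparison_test'[OF \<open>summable q\<close>])
    fix n
    have "a * q 0 \<le> (real n + real m) * q n"
      using lower[of n] m nonneg[of n]
      by (meson add_left_mono mult_right_mono order_trans)
    then show "norm (a * q 0 / (real n + real m)) \<le> q n"
      using a pos m by (simp add: field_simps)
  qed
  then have "summable (\<lambda>n. (1 / (a * q 0)) * (a * q 0 / (real n + real m)))"
    by (rule summable_mult)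
  then have "summable (\<lambda>n. inverse (real (n + m)))"
    using a pos by (simp add: field_simps)
  then have "summable (\<lambda>n. inverse (real n))"
    using summable_iff_shift[of "\<lambda>n. inverse (real n)" m] by simp
  then show False
    using not_summable_harmonic[where 'a = real] by simp
qed

text \<open>The law of \<open>X\<close> has its point masses as density with respect to counting
  measure, and for nonnegative \<open>f\<close> convergence of the series is the same as
  integrability. Moments thus reduce to series.\<close>

lemma (in prob_space) nat_rv_moment:
  fixes X :: "'a \<Rightarrow> nat" and f :: "nat \<Rightarrow> real"
  assumes X: "X \<in> measurable M (count_space {m..})"
    and f: "\<And>k. f k \<ge> 0"
    and sums: "(\<lambda>j. f (j + m) * prob {\<omega> \<in> space M. X \<omega> = j + m}) sums s"
  shows "integrable M (\<lambda>\<omega>. f (X \<omega>))" and "expectation (\<lambda>\<omega>. f (X \<omega>)) = s"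
proof -
  define P where "P k = prob {\<omega> \<in> space M. X \<omega> = k}" for k
  have ge: "X \<omega> \<ge> m" if "\<omega> \<in> space M" for \<omega>
    using measurable_space[OF X that] by simp
  have X': "X \<in> measurable M (count_space UNIV)"
    using measurable_compose[OF X, of "\<lambda>k. k" "count_space UNIV"] by simp
  have D: "distr M (count_space UNIV) X = density (count_space UNIV) (\<lambda>k. ennreal (P k))"
    (is "?D = ?E")
  proof (rule measure_eqI_countable[where A = UNIV])
    fix k
    have "X -` {k} \<inter> space M = {\<omega> \<in> space M. X \<omega> = k}" by auto
    then show "emeasure ?D {k} = emeasure ?E {k}"
      using X' by (simp add: emeasure_distr emeasure_density P_def emeasure_eq_measure
          nn_integral_count_space_indicator[symmetric] nn_integral_count_space_finite)
  qed auto
  \<comment> \<open>Values below \<open>m\<close> are never taken, so the series started at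
    \<open>m\<close> may be extended to all natural numbers with the same sum.\<close>
  have P0: "P k = 0" if "k < m" for k
  proof -
    have "{\<omega> \<in> space M. X \<omega> = k} = {}" using ge that by fastforce
    then show ?thesis unfolding P_def by (simp only: measure_empty)
  qed
  have "(\<lambda>k. P k * f k) sums (s + (\<Sum>k<m. P k * f k))"
    using sums sums_iff_shift[of "\<lambda>k. P k * f k" m s] by (simp add: P_def mult.commute)
  then have S: "(\<lambda>k. P k * f k) sums s" by (simp add: P0)
  have int: "integrable (count_space UNIV) (\<lambda>k. P k * f k)"
    using S f by (simp add: integrable_count_space_nat_iff sums_iff P_def)
  have "integrable ?E f"
    using int by (subst integrable_density) (auto simp: P_def)
  then show "integrable M (\<lambda>\<omega>. f (X \<omega>))"
    unfolding D[symmetric] by (subst (asm) integrable_distr_eq) (use X' in auto)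
  have "expectation (\<lambda>\<omega>. f (X \<omega>)) = integral\<^sup>L ?E f"
    unfolding D[symmetric] by (subst integral_distr) (use X' in auto)
  also have "\<dots> = (\<integral>k. P k * f k \<partial>count_space UNIV)"
    by (subst integral_density) (auto simp: P_def)
  also have "\<dots> = s"
    using sums_integral_count_space_nat[OF int] S sums_unique2 by blast
  finally show "expectation (\<lambda>\<omega>. f (X \<omega>)) = s" .
qed

text \<open>Passing from \<open>k\<close> to \<open>Suc k\<close> adds the factor
  \<open>1 - k * lam\<close> to the falling factorial and \<open>\<alpha> / Suc k\<close> to the
  exponential weight; the normalising constant stays the same.\<close>

lemma trunc_deg_poisson_mass_Suc:
  "real (Suc k) * trunc_deg_poisson_mass lam \<alpha> r (Suc k) =
     \<alpha> * (1 - real k * lam) * trunc_deg_poisson_mass lam \<alpha> r k"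
proof -
  let ?D = "degenerate_exp lam \<alpha> - degenerate_exp_trunc lam r \<alpha>"
  have pow: "real (Suc k) * (\<alpha> ^ Suc k / fact (Suc k)) = \<alpha> * (\<alpha> ^ k / fact k)"
    by (simp add: divide_simps del: of_nat_Suc)
  have "real (Suc k) * trunc_deg_poisson_mass lam \<alpha> r (Suc k) =
      degenerate_falling 1 lam (Suc k) / ?D * (real (Suc k) * (\<alpha> ^ Suc k / fact (Suc k)))"
    unfolding trunc_deg_poisson_mass_def by (rule mult.left_commute)
  also have "\<dots> = \<alpha> * (1 - real k * lam) * trunc_deg_poisson_mass lam \<alpha> r k"
    unfolding pow by (simp add: trunc_deg_poisson_mass_def degenerate_falling_def)
  finally show ?thesis .
qed

text \<open>Removing the first \<open>r + 1\<close> terms, those with index at most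
  \<open>r\<close>, from the exponential series leaves exactly the normalising denominator.\<close>

lemma trunc_deg_poisson_mass_sums:
  assumes "trunc_deg_poisson_params lam \<alpha> r"
  shows "(\<lambda>j. trunc_deg_poisson_mass lam \<alpha> r (j + (r + 1))) sums 1"
proof -
  let ?D = "degenerate_exp lam \<alpha> - degenerate_exp_trunc lam r \<alpha>"
  let ?t = "\<lambda>k. degenerate_falling 1 lam k * \<alpha> ^ k / fact k"
  have "?t sums degenerate_exp lam \<alpha>" and D: "?D \<noteq> 0"
    using assms by (auto simp: trunc_deg_poisson_params_def)
  then have "(\<lambda>j. ?t (j + (r + 1))) sums ?D"
    using sums_split_initial_segment[of ?t _ "r + 1"]
    by (simp add: degenerate_exp_trunc_def lessThan_Suc_atMost)
  then have "(\<lambda>j. ?t (j + (r + 1)) / ?D) sums (?D / ?D)"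
    by (rule sums_divide)
  then show ?thesis
    using D by (simp add: trunc_deg_poisson_mass_def mult_ac)
qed

theorem theorem2:
  fixes M :: "'a measure" and X :: "'a \<Rightarrow> nat" and lam \<alpha> :: real and r :: nat
  assumes "prob_space M"
    and "\<alpha> > 0"
    and "trunc_deg_poisson_rv M X lam \<alpha> r"
    and "lam \<noteq> - 1 / \<alpha>"
  shows "integrable M (\<lambda>\<omega>. (real (X \<omega>))\<^sup>2) \<and>
    prob_space.variance M (\<lambda>\<omega>. real (X \<omega>)) =
      1 / (1 + \<alpha> * lam)\<^sup>2
        * (\<alpha> + \<alpha> ^ (r + 1) / fact r
             * (degenerate_falling 1 lam (r + 1)
                  / (degenerate_exp lam \<alpha> - degenerate_exp_trunc lam r \<alpha>)))
        * (1 - \<alpha> ^ (r + 1) / fact r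
             * (degenerate_falling 1 lam (r + 1)
                  / (degenerate_exp lam \<alpha> - degenerate_exp_trunc lam r \<alpha>)))
      + 1 / (1 + \<alpha> * lam)
        * (real r * degenerate_falling 1 lam (r + 1)
             / (degenerate_exp lam \<alpha> - degenerate_exp_trunc lam r \<alpha>))
        * (\<alpha> ^ (r + 1) / fact r)"
proof -
  interpret prob_space M by fact
  note \<alpha> = \<open>\<alpha> > 0\<close>
  define p where "p = trunc_deg_poisson_mass lam \<alpha> r"
  define q where "q j = p (j + (r + 1))" for j
  define b where "b = \<alpha> * lam"
  \<comment> \<open>This is the boundary term left over when the recurrence is summed from
    \<open>r + 1\<close> on; it turns out to be the expression that recurs in the variance
    formula.\<close>
  define c where "c = real (r + 1) * q 0"
  have params: "trunc_deg_poisson_params lam \<alpha> r"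
    and X: "X \<in> measurable M (count_space {r + 1..})"
    and prob: "\<And>j. prob {\<omega> \<in> space M. X \<omega> = j + (r + 1)} = q j"
    using assms(3) by (auto simp: trunc_deg_poisson_rv_def p_def q_def)
  have q_nonneg: "q j \<ge> 0" for j
    using params by (simp add: trunc_deg_poisson_params_def p_def q_def)
  have q_sums: "q sums 1"
    using trunc_deg_poisson_mass_sums[OF params] by (simp add: q_def[abs_def] p_def)
  have rec: "real (Suc j + (r + 1)) * q (Suc j) = (\<alpha> - b * real (j + (r + 1))) * q j" for j
    using trunc_deg_poisson_mass_Suc[of "j + (r + 1)" lam \<alpha> r]
    by (simp add: q_def p_def b_def algebra_simps)
  \<comment> \<open>If the first mass vanished, \<open>rec\<close> would carry the zero to all later
    ones, contradicting total mass 1.\<close>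
  have "q 0 \<noteq> 0"
  proof
    assume "q 0 = 0"
    have "q j = 0" for j
    proof (induction j)
      case (Suc j)
      with rec[of j] show ?case by (simp del: of_nat_Suc of_nat_add)
    qed fact
    then have "q = (\<lambda>j. 0)" by blast
    then show False using q_sums by (simp add: sums_iff)
  qed
  have "b \<noteq> -1"
    using assms(4) \<alpha> by (auto simp: b_def field_simps)
  moreover have "\<not> b < -1"
  proof
    assume b: "b < -1"
    have "\<not> summable q"
    proof (rule not_summable_of_growth[where a = "real (r + 1)"])
      fix j
      \<comment> \<open>With \<open>-b > 1\<close> and \<open>\<alpha> > 0\<close>, the factor
        \<open>\<alpha> - b * k\<close> in \<open>rec\<close> is at least \<open>k\<close>, where
        \<open>k = j + (r + 1)\<close>.\<close>
      have "real (j + (r + 1)) * 1 \<le> real (j + (r + 1)) * (- b)"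
        using b by (intro mult_left_mono) auto
      then have "real (j + (r + 1)) \<le> \<alpha> - b * real (j + (r + 1))"
        using \<alpha> by (simp add: mult.commute)
      then have "real (j + (r + 1)) * q j \<le> (\<alpha> - b * real (j + (r + 1))) * q j"
        by (rule mult_right_mono) (rule q_nonneg)
      then show "(real j + real (r + 1)) * q j \<le> (real (Suc j) + real (r + 1)) * q (Suc j)"
        unfolding rec[symmetric] by (simp add: add_ac)
    qed (use q_nonneg \<open>q 0 \<noteq> 0\<close> in \<open>auto simp: less_le\<close>)
    then show False using q_sums sums_summable by blast
  qed
  ultimately have b: "b > -1" by linarith
  \<comment> \<open>\<open>m\<close> and \<open>s\<close> are the sums predicted by
    \<open>sums_affine_recurrence\<close> for \<open>k * q\<close> and \<open>k^2 * q\<close>, whose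
    initial terms are \<open>c\<close> and \<open>(r + 1) * c\<close>.\<close>
  define m where "m = (c + \<alpha>) / (1 + b)"
  define s where "s = (real (r + 1) * c + (\<alpha> + (\<alpha> - b) * m)) / (1 + b)"
  have first: "(\<lambda>j. real (j + (r + 1)) * q j) sums m"
  proof -
    have "(\<lambda>j. \<alpha> * q j) sums (\<alpha> * 1)"
      by (intro sums_mult q_sums)
    then have "(\<lambda>j. real (j + (r + 1)) * q j) sums ((real (0 + (r + 1)) * q 0 + \<alpha> * 1) / (1 + b))"
      by (rule sums_affine_recurrence[rotated 2, OF _ b])
        (use q_nonneg in \<open>simp_all only: rec, auto simp: algebra_simps\<close>)
    then show ?thesis by (simp add: m_def c_def)
  qed
  have second: "(\<lambda>j. (real (j + (r + 1)))\<^sup>2 * q j) sums s"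
  proof -
    have y: "(\<lambda>j. \<alpha> * q j + (\<alpha> - b) * (real (j + (r + 1)) * q j)) sums (\<alpha> * 1 + (\<alpha> - b) * m)"
      by (intro sums_add sums_mult q_sums first)
    have "(\<lambda>j. (real (j + (r + 1)))\<^sup>2 * q j) sums
        (((real (0 + (r + 1)))\<^sup>2 * q 0 + (\<alpha> * 1 + (\<alpha> - b) * m)) / (1 + b))"
    proof (rule sums_affine_recurrence[OF _ _ y b])
      fix j
      \<comment> \<open>Multiplying \<open>rec\<close> by \<open>k + 1\<close> gives the factor
        \<open>(k + 1) * (\<alpha> - b * k) = \<alpha> + (\<alpha> - b) * k - b * k^2\<close>; the
        quadratic part moves to the left-hand side of the recurrence.\<close>
      have "(real (Suc j + (r + 1)))\<^sup>2 * q (Suc j)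
          = real (Suc j + (r + 1)) * ((\<alpha> - b * real (j + (r + 1))) * q j)"
        unfolding rec[symmetric] by (simp add: power2_eq_square)
      then show "(real (Suc j + (r + 1)))\<^sup>2 * q (Suc j) + b * ((real (j + (r + 1)))\<^sup>2 * q j)
          = \<alpha> * q j + (\<alpha> - b) * (real (j + (r + 1)) * q j)"
        by (simp add: algebra_simps power2_eq_square)
    qed (simp add: q_nonneg)
    then show ?thesis
      by (simp add: s_def c_def power2_eq_square mult.assoc)
  qed
  have int1: "integrable M (\<lambda>\<omega>. real (X \<omega>))" and m: "expectation (\<lambda>\<omega>. real (X \<omega>)) = m"
    using nat_rv_moment[OF X, of real m] first by (simp_all only: prob of_nat_0_le_iff)
  have int2: "integrable M (\<lambda>\<omega>. (real (X \<omega>))\<^sup>2)"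
    and s: "expectation (\<lambda>\<omega>. (real (X \<omega>))\<^sup>2) = s"
    using nat_rv_moment[OF X, of "\<lambda>k. (real k)\<^sup>2" s] second by (simp_all only: prob zero_le_power2)
  have var: "variance (\<lambda>\<omega>. real (X \<omega>)) = s - m\<^sup>2"
    using variance_eq[OF int1 int2] m s by simp
  have "s - m\<^sup>2 = 1 / (1 + b)\<^sup>2 * (\<alpha> + c) * (1 - c) + 1 / (1 + b) * (real r * c)"
  proof -
    \<comment> \<open>Writing \<open>s\<close> so that \<open>b\<close> occurs only in the product
      \<open>b * d\<close>, which equals \<open>1 - d\<close>, turns the rational identity into a
      polynomial one in \<open>\<alpha>\<close>, \<open>c\<close>, \<open>d\<close> and
      \<open>r\<close>.\<close>
    define d where "d = 1 / (1 + b)"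
    have d: "b * d = 1 - d" using b by (simp add: d_def field_simps)
    have "s = ((real r + 1) * c + \<alpha>) * d + (\<alpha> * d - b * d) * (c + \<alpha>) * d"
      by (simp add: s_def m_def d_def divide_inverse algebra_simps)
    moreover have "m = (c + \<alpha>) * d" by (simp add: m_def d_def)
    moreover have "1 / (1 + b)\<^sup>2 = d\<^sup>2" by (simp add: d_def power_divide)
    ultimately show ?thesis
      unfolding d d_def[symmetric] by (simp add: algebra_simps power2_eq_square)
  qed
  moreover have "c = \<alpha> ^ (r + 1) / fact r * (degenerate_falling 1 lam (r + 1)
      / (degenerate_exp lam \<alpha> - degenerate_exp_trunc lam r \<alpha>))"
  proof -
    \<comment> \<open>The factor \<open>r + 1\<close> in \<open>c\<close> cancels against
      \<open>fact (r + 1)\<close>, which is why \<open>fact r\<close> appears in the result.\<close>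
    have "real (r + 1) * (\<alpha> ^ (r + 1) / fact (r + 1)) = \<alpha> ^ (r + 1) / fact r"
      by (simp add: divide_simps del: of_nat_Suc)
    then show ?thesis
      unfolding c_def q_def p_def trunc_deg_poisson_mass_def add_0
      by (metis mult.commute mult.left_commute)
  qed
  ultimately show ?thesis
    using int2 var by (simp add: b_def mult_ac)
qed

end
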